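(* Let $r=r(n)$ be a function of $n$ taking integer values $r(n)\ge 2$ and satisfying $r(n)=o\!\left(\frac{\ln n}{\ln\ln n}\right)$ as $n\to\infty$. For an integer $r\ge 2$ put $$q'(r)=\frac{(r!)^{1/r}}{2^{1/r}\left(1-\frac1r\right)^{\frac{r-1}{r}}\, r^{\frac{r-2}{r}}}.$$ Then for every $\varepsilon\in(0,1)$ there exists $n_0$ such that for every $n\ge n_0$, writing $r=r(n)$, $$m(n,r)\ \ge\ (1-\varepsilon)\,q'(r)\left(\frac{n}{\ln n}\right)^{\frac{r-1}{r}} r^{\,n-1}.$$ In particular, for fixed $r\ge2$ and any constant $q<q'(r)$, one has $m(n,r)\ge q\left(\frac{n}{\ln n}\right)^{\frac{r-1}{r}} r^{n-1}$ for all sufficiently large $n$.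
   Context: A hypergraph $H=(V,E)$ consists of a finite vertex set $V$ and a family $E$ of subsets of $V$ (edges); it is $n$-uniform if every edge has exactly $n$ vertices. A coloring of $V$ with $r$ colors is proper if no edge is monochromatic (all vertices of one color). The chromatic number of $H$ is the least $r$ for which a proper $r$-coloring exists. For integers $n\ge2$, $r\ge2$, $m(n,r)$ denotes the minimum number of edges of an $n$-uniform hypergraph whose chromatic number is greater than $r$. *)

theory Defs
  imports Complex_Main "HOL-Library.Landau_Symbols"
begin

definition uniform_hypergraph :: "nat \<Rightarrow> nat set \<Rightarrow> nat set set \<Rightarrow> bool" where
  "uniform_hypergraph n V E \<longleftrightarrow> finite V \<and> (\<forall>e\<in>E. e \<subseteq> V \<and> card e = n)"

definition proper_coloring :: "nat set \<Rightarrow> nat set set \<Rightarrow> nat \<Rightarrow> (nat \<Rightarrow> nat) \<Rightarrow> bool" where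
  "proper_coloring V E r f \<longleftrightarrow> (\<forall>v\<in>V. f v < r) \<and> (\<forall>e\<in>E. \<not> (\<exists>c. \<forall>v\<in>e. f v = c))"

definition chromatic_number :: "nat set \<Rightarrow> nat set set \<Rightarrow> nat" where
  "chromatic_number V E = (LEAST r. \<exists>f. proper_coloring V E r f)"

definition m_hyp :: "nat \<Rightarrow> nat \<Rightarrow> nat" where
  "m_hyp n r = (LEAST k. \<exists>V E. uniform_hypergraph n V E \<and> finite E \<and> chromatic_number V E > r \<and> card E = k)"

definition q' :: "nat \<Rightarrow> real" where
  "q' r = (fact r) powr (1 / real r) /
     (2 powr (1 / real r) * (1 - 1 / real r) powr ((real r - 1) / real r)
      * real r powr ((real r - 2) / real r))"

end

(* A vertex v receives a position f v in M = rD + (r-1)d cells, arranged in r blocks of D early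
   and d late cells (the last block has no late cells).  The colour of v is the index of its block,
   raised by one if v is in a late cell and is the last vertex of an edge that would otherwise be
   monochromatic.  A monochromatic edge of colour c then forces a chain of edges e_a, ..., e_c in
   which consecutive edges share exactly one vertex, placed in a late cell, and by AM-GM applied to
   the distances of these cells few functions f realise a given chain.  With L = n / ln n, a late
   cell proportion d/M slightly above 1/(rL) and (1 - eps) (r L^(r-1))^(1/r) r^(n-1) edges, a chain
   of l + 1 edges has expected number at most (1 - eps)(1 + o(1)) rho^(r-1-l) for each starting
   block, where rho = n^(-eps/(2r)) tends to 0 because r = o(ln n); summing over all chains gives
   a number below 1.  The theorem follows since q'(r) <= r^(1/r). *)

theory Submission
  imports Defs "HOL-Library.FuncSet" "HOL-Real_Asymp.Real_Asymp"
begin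

section \<open>Recolouring rule and chains of edges\<close>

text \<open>The last block needs no case distinction: positions are taken below M = r * D + (r - 1)
  * d, and this is exactly where the late cells of block r - 1 would begin.\<close>

definition late :: "nat \<Rightarrow> nat \<Rightarrow> nat \<Rightarrow> nat set" where
  "late D d i = {i * (D + d) + D..<Suc i * (D + d)}"

text \<open>
  The late vertices of block \<open>i\<close> that are recoloured to \<open>Suc i\<close>. Contrary to the usual greedy rule, an
  edge may witness this even if some of its other vertices in block \<open>i\<close> are recoloured themselves; this
  makes the recursion monotone. The injective key \<open>\<kappa>\<close> refines the
  order given by \<open>f\<close> and breaks ties.
\<close>

primrec bumped :: "nat set \<Rightarrow> nat set set \<Rightarrow> nat \<Rightarrow> nat \<Rightarrow> (nat \<Rightarrow> nat) \<Rightarrow> (nat \<Rightarrow> nat) \<Rightarrow> nat \<Rightarrow> nat set" where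
  "bumped V E D d f \<kappa> 0 = {}"
| "bumped V E D d f \<kappa> (Suc i) = {v \<in> V. f v \<in> late D d i \<and>
     (\<exists>e\<in>E. v \<in> e \<and> (\<forall>w\<in>e. \<kappa> w \<le> \<kappa> v) \<and>
        (\<forall>w\<in>e. f w div (D + d) = i \<or> w \<in> bumped V E D d f \<kappa> i))}"

definition bump_coloring :: "nat set \<Rightarrow> nat set set \<Rightarrow> nat \<Rightarrow> nat \<Rightarrow> (nat \<Rightarrow> nat) \<Rightarrow> (nat \<Rightarrow> nat) \<Rightarrow> nat \<Rightarrow> nat" where
  "bump_coloring V E D d f \<kappa> v = (let i = f v div (D + d)
     in if v \<in> bumped V E D d f \<kappa> (Suc i) then Suc i else i)"

text \<open>No upper bound is imposed on the positions in the last edge, so that a chain can be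
  extended edge by edge in \<open>ex_edge_chain\<close>. The bound for the final edge is supplied by
  \<open>edge_chain_if_monochromatic\<close>.\<close>

definition edge_chain :: "nat set set \<Rightarrow> nat \<Rightarrow> nat \<Rightarrow> (nat \<Rightarrow> nat) \<Rightarrow> (nat \<Rightarrow> nat) \<Rightarrow> nat \<Rightarrow> nat \<Rightarrow> (nat \<Rightarrow> nat set) \<Rightarrow> (nat \<Rightarrow> nat) \<Rightarrow> bool" where
  "edge_chain E D d f \<kappa> a c es vs \<longleftrightarrow> a \<le> c \<and> (\<forall>j\<in>{a..c}. es j \<in> E) \<and>
     (\<forall>j\<in>{a..<c}. vs j \<in> es j \<inter> es (Suc j) \<and> f (vs j) \<in> late D d j \<and>
        (\<forall>w\<in>es j. \<kappa> w \<le> \<kappa> (vs j)) \<and> (\<forall>w\<in>es (Suc j). \<kappa> (vs j) \<le> \<kappa> w)) \<and>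
     (\<forall>w\<in>es a. a * (D + d) \<le> f w)"

lemma late_div:
  assumes "x \<in> late D d i"
  shows "x div (D + d) = i"
proof -
  have "i * (D + d) \<le> x" "x < Suc i * (D + d)" using assms by (auto simp: late_def)
  thus ?thesis by (metis div_nat_eqI mult.commute)
qed

lemma bumped_late: "v \<in> bumped V E D d f \<kappa> (Suc i) \<Longrightarrow> f v \<in> late D d i"
  by simp

lemma finite_ex_argmax:
  fixes \<kappa> :: "nat \<Rightarrow> nat"
  assumes "finite e" "e \<noteq> {}"
  shows "\<exists>v\<in>e. \<forall>w\<in>e. \<kappa> w \<le> \<kappa> v"
proof -
  have "Max (\<kappa> ` e) \<in> \<kappa> ` e" using assms by (intro Max_in) auto
  then obtain v where "v \<in> e" "\<kappa> v = Max (\<kappa> ` e)" by force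
  thus ?thesis using assms by (metis Max_ge finite_imageI imageI)
qed

text \<open>Unless all of \<open>e\<close> lies in block \<open>i\<close>, its \<kappa>-least vertex
  \<open>v\<close> lies before that block and so must have been recoloured. The edge witnessing this
  has \<open>v\<close> as its \<kappa>-greatest vertex and satisfies the same hypothesis one block
  lower; the induction hypothesis gives a chain ending in it, and \<open>e\<close> is appended with
  linking vertex \<open>v\<close>.\<close>

lemma ex_edge_chain:
  assumes E: "\<And>e. e \<in> E \<Longrightarrow> e \<subseteq> V"
    and mono: "\<And>v w. v \<in> V \<Longrightarrow> w \<in> V \<Longrightarrow> \<kappa> w \<le> \<kappa> v \<Longrightarrow> f w \<le> f v"
    and "e \<in> E" "\<And>w. w \<in> e \<Longrightarrow> f w div (D + d) = i \<or> w \<in> bumped V E D d f \<kappa> i"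
  shows "\<exists>a es vs. edge_chain E D d f \<kappa> a i es vs \<and> es i = e"
  using assms(3,4)
proof (induction i arbitrary: e)
  case 0
  have "edge_chain E D d f \<kappa> 0 0 (\<lambda>_. e) (\<lambda>_. 0)"
    using 0 by (auto simp: edge_chain_def)
  thus ?case by blast
next
  case (Suc i)
  show ?case
  proof (cases "\<forall>w\<in>e. f w div (D + d) = Suc i")
    case True
    have "Suc i * (D + d) \<le> f w" if "w \<in> e" for w
      using True that by (metis div_times_less_eq_dividend)
    hence "edge_chain E D d f \<kappa> (Suc i) (Suc i) (\<lambda>_. e) (\<lambda>_. 0)"
      using Suc.prems by (auto simp: edge_chain_def)
    thus ?thesis by blast
  next
    case False
    then obtain w where w: "w \<in> e" "f w div (D + d) \<noteq> Suc i" by blast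
    hence wb: "w \<in> bumped V E D d f \<kappa> (Suc i)" using Suc.prems by blast
    obtain v where v: "v \<in> e" "\<And>u. u \<in> e \<Longrightarrow> \<kappa> v \<le> \<kappa> u"
      using w(1) arg_min_nat_lemma[of "\<lambda>x. x \<in> e" w \<kappa>] by blast
    have "f v \<le> f w" using mono v w E[OF Suc.prems(1)] by blast
    moreover have "f w < Suc i * (D + d)" using bumped_late[OF wb] by (simp add: late_def)
    ultimately have "f v div (D + d) \<noteq> Suc i"
      by (metis div_times_less_eq_dividend leD le_less_trans)
    hence vb: "v \<in> bumped V E D d f \<kappa> (Suc i)" using Suc.prems(2) v(1) by blast
    then obtain e' where e': "e' \<in> E" "v \<in> e'" "\<forall>w\<in>e'. \<kappa> w \<le> \<kappa> v"
      "\<And>w. w\<in>e' \<Longrightarrow> f w div (D + d) = i \<or> w \<in> bumped V E D d f \<kappa> i" by auto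
    from Suc.IH[OF e'(1,4)] obtain a es vs
      where ch: "edge_chain E D d f \<kappa> a i es vs" "es i = e'" by blast
    have "edge_chain E D d f \<kappa> a (Suc i) (es(Suc i := e)) (vs(i := v))"
      using ch e'(1-3) v Suc.prems(1) bumped_late[OF vb]
      by (auto simp: edge_chain_def less_Suc_eq le_Suc_eq)
    thus ?thesis by (metis fun_upd_same)
  qed
qed

text \<open>A vertex of colour \<open>c\<close> lies in block \<open>c\<close> or was raised from
  the block before, so \<open>ex_edge_chain\<close> applies to \<open>e\<close>. If the
  \<kappa>-greatest vertex of \<open>e\<close> were late in block \<open>c\<close>, then
  \<open>e\<close> itself would be a reason to raise it to \<open>Suc c\<close>. Hence that vertex,
  and with it all of \<open>e\<close>, lies before the late cells of block \<open>c\<close>.\<close>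

lemma edge_chain_if_monochromatic:
  assumes E: "\<And>e. e \<in> E \<Longrightarrow> e \<subseteq> V" and fin: "finite V"
    and mono: "\<And>v w. v \<in> V \<Longrightarrow> w \<in> V \<Longrightarrow> \<kappa> w \<le> \<kappa> v \<Longrightarrow> f w \<le> f v"
    and e: "e \<in> E" "e \<noteq> {}" and D: "0 < D"
    and col: "\<And>v. v \<in> e \<Longrightarrow> bump_coloring V E D d f \<kappa> v = c"
  shows "\<exists>a es vs. edge_chain E D d f \<kappa> a c es vs \<and> (\<forall>w\<in>es c. f w < c * (D + d) + D)"
proof -
  have cov: "f w div (D + d) = c \<or> w \<in> bumped V E D d f \<kappa> c" if "w \<in> e" for w
    using col[OF that] by (auto simp: bump_coloring_def Let_def split: if_splits)
  obtain a es vs where ch: "edge_chain E D d f \<kappa> a c es vs" "es c = e"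
    using ex_edge_chain[OF E mono e(1) cov] by blast
  have "finite e" using E[OF e(1)] fin finite_subset by blast
  then obtain v where v: "v \<in> e" "\<And>w. w \<in> e \<Longrightarrow> \<kappa> w \<le> \<kappa> v"
    using finite_ex_argmax e(2) by meson
  have vV: "v \<in> V" using v E e by blast
  have "f v \<notin> late D d c"
  proof
    assume late: "f v \<in> late D d c"
    hence "v \<in> bumped V E D d f \<kappa> (Suc c)" using v e(1) cov vV by auto
    moreover have "f v div (D + d) = c" by (rule late_div[OF late])
    ultimately show False using col[OF v(1)] by (simp add: bump_coloring_def)
  qed
  moreover have "f v < Suc c * (D + d)"
    using cov[OF v(1)]
  proof
    assume "f v div (D + d) = c"
    thus ?thesis using D
      by (metis add_gr_0 dividend_less_times_div mult.commute mult_Suc_right)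
  next
    assume *: "v \<in> bumped V E D d f \<kappa> c"
    then obtain i where "c = Suc i" by (cases c) auto
    thus ?thesis using * by (auto simp: late_def)
  qed
  ultimately have "f v < c * (D + d) + D" by (auto simp: late_def)
  moreover have "f w \<le> f v" if "w \<in> e" for w using mono v that E e by blast
  ultimately show ?thesis using ch by (metis le_less_trans)
qed

section \<open>Intersection pattern of a chain\<close>

text \<open>The part of a chain's structure that mentions neither \<open>f\<close> nor \<kappa>: the
  union bound runs over edge sequences with this pattern before any function is fixed.\<close>

definition linked :: "nat \<Rightarrow> nat \<Rightarrow> (nat \<Rightarrow> nat set) \<Rightarrow> (nat \<Rightarrow> nat) \<Rightarrow> bool" where
  "linked a c es vs \<longleftrightarrow> (\<forall>j\<in>{a..<c}. es j \<inter> es (Suc j) = {vs j}) \<and>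
     (\<forall>j\<in>{a..c}. \<forall>k\<in>{a..c}. j + 2 \<le> k \<longrightarrow> es j \<inter> es k = {})"

lemma late_less:
  assumes "x \<in> late D d i" "y \<in> late D d j" "i < j"
  shows "x < y"
proof -
  have "x < Suc i * (D + d)" using assms by (simp add: late_def)
  also have "\<dots> \<le> j * (D + d)" using assms(3) by (intro mult_right_mono) auto
  also have "\<dots> \<le> y" using assms by (simp add: late_def)
  finally show ?thesis .
qed

text \<open>A common vertex of consecutive edges has the same key as the linking vertex, and keys
  are injective. For edges further apart, the linking vertex above the lower edge and the one below
  the upper edge are late in different blocks, so their keys are strictly ordered and separate the
  two edges.\<close>

lemma linked_edge_chain:
  assumes E: "\<And>e. e \<in> E \<Longrightarrow> e \<subseteq> V"
    and inj: "inj_on \<kappa> V"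
    and mono: "\<And>v w. v \<in> V \<Longrightarrow> w \<in> V \<Longrightarrow> \<kappa> w \<le> \<kappa> v \<Longrightarrow> f w \<le> f v"
    and ch: "edge_chain E D d f \<kappa> a c es vs"
  shows "linked a c es vs"
proof -
  have V: "w \<in> V" if "w \<in> es j" "j \<in> {a..c}" for w j
  proof -
    have "es j \<in> E" using ch that(2) by (auto simp: edge_chain_def)
    thus ?thesis using E that(1) by blast
  qed
  have vV: "vs j \<in> V" if "j \<in> {a..<c}" for j
    using that ch V[of "vs j" j] by (auto simp: edge_chain_def)
  have up: "\<kappa> w \<le> \<kappa> (vs j)" if "j \<in> {a..<c}" "w \<in> es j" for j w
    using that ch by (auto simp: edge_chain_def)
  have low: "\<kappa> (vs j) \<le> \<kappa> w" if "j \<in> {a..<c}" "w \<in> es (Suc j)" for j w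
    using that ch by (auto simp: edge_chain_def)
  have "es j \<inter> es (Suc j) = {vs j}" if j: "j \<in> {a..<c}" for j
  proof -
    have "w = vs j" if "w \<in> es j" "w \<in> es (Suc j)" for w
    proof -
      have "\<kappa> w = \<kappa> (vs j)" using up[OF j] low[OF j] that by (meson le_antisym)
      moreover have "w \<in> V" using V[of w j] that j by simp
      ultimately show ?thesis using inj vV[OF j] by (meson inj_onD)
    qed
    thus ?thesis using ch j by (auto simp: edge_chain_def)
  qed
  moreover have "es j \<inter> es k = {}" if jk: "j \<in> {a..c}" "k \<in> {a..c}" "j + 2 \<le> k" for j k
  proof -
    obtain k' where k': "k = Suc k'" using jk by (cases k) auto
    have *: "j \<in> {a..<c}" "k' \<in> {a..<c}" "j < k'" using jk k' by auto
    have "f (vs j) < f (vs k')"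
      using late_less[of "f (vs j)" D d j "f (vs k')" k'] ch * by (auto simp: edge_chain_def)
    hence "\<kappa> (vs j) < \<kappa> (vs k')" using mono[OF vV[OF *(1)] vV[OF *(2)]] by linarith
    hence "\<not> (w \<in> es j \<and> w \<in> es k)" for w
      using up[OF *(1), of w] low[OF *(2), of w] k' by (meson leD le_trans)
    thus ?thesis by blast
  qed
  ultimately show ?thesis by (auto simp: linked_def)
qed

section \<open>Counting the functions that realise a given chain\<close>

lemma prod_le_prod_subset:
  fixes h :: "nat \<Rightarrow> real"
  assumes "finite A" "B \<subseteq> A" "\<And>x. x \<in> A \<Longrightarrow> 0 \<le> h x \<and> h x \<le> 1"
  shows "prod h A \<le> prod h B"
proof -
  have "prod h A = prod h (A - B) * prod h B" using assms by (simp add: prod.subset_diff)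
  also have "\<dots> \<le> 1 * prod h B"
    using assms by (intro mult_right_mono prod_le_1 prod_nonneg) auto
  finally show ?thesis by simp
qed

text \<open>
  A linking vertex has a single admissible cell, since the ranges of its two edges meet in one point;
  this is the source of the factor \<open>(1 / M) ^ (c - a)\<close>.
\<close>

lemma card_linked_le:
  fixes M n :: nat and lo hi :: "nat \<Rightarrow> nat"
  assumes fin: "finite V" and M: "0 < M" and ac: "a \<le> c"
    and es: "\<And>j. j \<in> {a..c} \<Longrightarrow> es j \<subseteq> V \<and> card (es j) = n"
    and link: "linked a c es vs"
    and hl: "\<And>j. j \<in> {a..<c} \<Longrightarrow> hi j = lo (Suc j)"
    and lh: "\<And>j. j \<in> {a..c} \<Longrightarrow> lo j \<le> hi j \<and> hi j < M"
  shows "real (card {f \<in> PiE V (\<lambda>_. {..<M}). \<forall>j\<in>{a..c}. \<forall>w\<in>es j. lo j \<le> f w \<and> f w \<le> hi j})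
     \<le> real M ^ card V * ((1 / real M) ^ (c - a) *
        (\<Prod>j=a..c. (real (hi j + 1 - lo j) / real M) ^ (n - (if j = a then 0 else 1) - (if j = c then 0 else 1))))"
proof -
  \<comment> \<open>\<open>S w\<close> collects the cells allowed at \<open>w\<close>, and
    \<open>h w\<close> is their proportion. The constraints on different vertices are independent,
    so the admissible functions have proportion at most \<open>prod h V\<close>. \<open>W\<close>
    holds the linking vertices and \<open>A j\<close> the other vertices of
    \<open>es j\<close>.\<close>
  define S where "S w = {x. x < M \<and> (\<forall>j\<in>{a..c}. w \<in> es j \<longrightarrow> lo j \<le> x \<and> x \<le> hi j)}" for w
  define W where "W = vs ` {a..<c}"
  define A where "A j = es j - W" for j
  define h where "h w = real (card (S w)) / real M" for w
  have link1: "es j \<inter> es (Suc j) = {vs j}" if "j \<in> {a..<c}" for j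
    using link that by (auto simp: linked_def)
  have link2: "es j \<inter> es k = {}" if "j \<in> {a..c}" "k \<in> {a..c}" "j + 2 \<le> k" for j k
    using link that by (auto simp: linked_def)
  have vs: "vs j \<in> es j" "vs j \<in> es (Suc j)" if "j \<in> {a..<c}" for j
    using link1[OF that] by auto
  have finS: "finite (S w)" for w
    by (rule finite_subset[of _ "{..<M}"]) (auto simp: S_def)
  have "card (S w) \<le> card {..<M}" for w by (rule card_mono) (auto simp: S_def)
  hence h01: "0 \<le> h w \<and> h w \<le> 1" for w using M by (simp add: h_def)
  have finE: "finite (es j)" if "j \<in> {a..c}" for j using es[OF that] fin finite_subset by blast
  have inj: "inj_on vs {a..<c}"
  proof (rule linorder_inj_onI)
    fix j k assume "j < k" "j \<in> {a..<c}" "k \<in> {a..<c}"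
    thus "vs j \<noteq> vs k" using link2[of j "Suc k"] vs[of j] vs[of k] by auto
  qed auto
  have hW: "h w \<le> 1 / real M" if wW: "w \<in> W" for w
  proof -
    obtain j where j: "j \<in> {a..<c}" "w = vs j" using wW by (auto simp: W_def)
    have "S w \<subseteq> {hi j}"
    proof
      fix x assume x: "x \<in> S w"
      have "j \<in> {a..c}" "Suc j \<in> {a..c}" using j by auto
      hence "x \<le> hi j" "lo (Suc j) \<le> x" using x vs[OF j(1)] j(2) unfolding S_def by blast+
      thus "x \<in> {hi j}" using hl[OF j(1)] by simp
    qed
    hence "card (S w) \<le> 1" using card_mono[of "{hi j}" "S w"] by simp
    thus ?thesis using M by (simp add: h_def divide_right_mono)
  qed
  have hA: "h w \<le> real (hi j + 1 - lo j) / real M" if "w \<in> es j" "j \<in> {a..c}" for w j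
  proof -
    have "S w \<subseteq> {lo j..hi j}" using that by (auto simp: S_def)
    hence "card (S w) \<le> card {lo j..hi j}" by (intro card_mono) auto
    thus ?thesis using M by (simp add: h_def divide_right_mono)
  qed
  have disj: "A j \<inter> A k = {}" if "j \<in> {a..c}" "k \<in> {a..c}" "j < k" for j k
  proof (cases "k = Suc j")
    case True
    thus ?thesis using link1[of j] that by (auto simp: A_def W_def)
  next
    case False
    thus ?thesis using link2[of j k] that by (auto simp: A_def)
  qed
  hence disj': "A j \<inter> A k = {}" if "j \<in> {a..c}" "k \<in> {a..c}" "j \<noteq> k" for j k
    using that by (metis Int_commute linorder_neqE_nat)
  \<comment> \<open>By the intersection pattern \<open>es j\<close> contains at most the linking
    vertices \<open>vs (j - 1)\<close> and \<open>vs j\<close>; the first is absent for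
    \<open>j = a\<close>, the second for \<open>j = c\<close>.\<close>
  have cardA: "n - (if j = a then 0 else 1) - (if j = c then 0 else 1) \<le> card (A j)"
    if j: "j \<in> {a..c}" for j
  proof -
    have "es j \<inter> W \<subseteq> (if j = a then {} else {vs (j - 1)}) \<union> (if j = c then {} else {vs j})"
    proof
      fix w assume w: "w \<in> es j \<inter> W"
      then obtain k where k: "k \<in> {a..<c}" "w = vs k" by (auto simp: W_def)
      have "\<not> k + 2 \<le> j" using link2[of k j] vs[OF k(1)] k w j by auto
      moreover have "\<not> j + 2 \<le> Suc k" using link2[of j "Suc k"] vs[OF k(1)] k w j by auto
      ultimately have "k = j \<or> j = Suc k" by linarith
      thus "w \<in> (if j = a then {} else {vs (j - 1)}) \<union> (if j = c then {} else {vs j})"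
        using k j by auto
    qed
    hence "card (es j \<inter> W) \<le> card ((if j = a then {} else {vs (j - 1)}) \<union> (if j = c then {} else {vs j}))"
      by (intro card_mono) auto
    also have "\<dots> \<le> (if j = a then 0 else 1) + (if j = c then 0 else 1)"
      by (rule order.trans[OF card_Un_le]) auto
    finally have "card (es j \<inter> W) \<le> (if j = a then 0 else 1) + (if j = c then 0 else 1)" .
    moreover have "card (A j) = n - card (es j \<inter> W)"
      unfolding A_def using es[OF j] finE[OF j] by (simp add: card_Diff_subset_Int)
    ultimately show ?thesis by auto
  qed
  have WV: "W \<subseteq> V" using es vs by (fastforce simp: W_def)
  have AV: "(\<Union>j\<in>{a..c}. A j) \<subseteq> V" using es by (fastforce simp: A_def)
  \<comment> \<open>Vertices outside the chain contribute factors at most 1 and are dropped.\<close>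
  have "prod h V \<le> prod h (W \<union> (\<Union>j\<in>{a..c}. A j))"
    using fin WV AV h01 by (intro prod_le_prod_subset) auto
  also have "\<dots> = prod h W * prod h (\<Union>j\<in>{a..c}. A j)"
    using fin WV AV by (intro prod.union_disjoint) (auto simp: A_def intro: finite_subset)
  also have "prod h (\<Union>j\<in>{a..c}. A j) = (\<Prod>j=a..c. prod h (A j))"
    using disj' finE by (intro prod.UNION_disjoint) (auto simp: A_def)
  also have "prod h W * (\<Prod>j=a..c. prod h (A j)) \<le> (1 / real M) ^ (c - a) *
      (\<Prod>j=a..c. (real (hi j + 1 - lo j) / real M) ^ (n - (if j = a then 0 else 1) - (if j = c then 0 else 1)))"
  proof (intro mult_mono prod_mono conjI)
    have "prod h W \<le> (\<Prod>w\<in>W. 1 / real M)" using h01 hW by (intro prod_mono) auto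
    also have "\<dots> = (1 / real M) ^ (c - a)" using inj by (simp add: W_def card_image)
    finally show "prod h W \<le> (1 / real M) ^ (c - a)" .
    fix j assume j: "j \<in> {a..c}"
    have "prod h (A j) \<le> (\<Prod>w\<in>A j. real (hi j + 1 - lo j) / real M)"
      using h01 hA j by (intro prod_mono) (auto simp: A_def)
    also have "\<dots> = (real (hi j + 1 - lo j) / real M) ^ card (A j)" by simp
    \<comment> \<open>The base is at most 1 because \<open>hi j < M\<close>, so a smaller exponent
      gives an upper bound.\<close>
    also have "\<dots> \<le> (real (hi j + 1 - lo j) / real M) ^ (n - (if j = a then 0 else 1) - (if j = c then 0 else 1))"
      using cardA[OF j] lh[OF j] M by (intro power_decreasing) auto
    finally show "prod h (A j) \<le> (real (hi j + 1 - lo j) / real M) ^ (n - (if j = a then 0 else 1) - (if j = c then 0 else 1))" .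
  qed (use h01 in \<open>auto intro!: prod_nonneg\<close>)
  finally have hV: "prod h V \<le> (1 / real M) ^ (c - a) *
      (\<Prod>j=a..c. (real (hi j + 1 - lo j) / real M) ^ (n - (if j = a then 0 else 1) - (if j = c then 0 else 1)))" .
  have "{f \<in> PiE V (\<lambda>_. {..<M}). \<forall>j\<in>{a..c}. \<forall>w\<in>es j. lo j \<le> f w \<and> f w \<le> hi j} \<subseteq> PiE V S"
    by (auto simp: S_def PiE_iff extensional_def)
  hence "card {f \<in> PiE V (\<lambda>_. {..<M}). \<forall>j\<in>{a..c}. \<forall>w\<in>es j. lo j \<le> f w \<and> f w \<le> hi j} \<le> card (PiE V S)"
    using fin finS by (intro card_mono finite_PiE) auto
  also have "\<dots> = (\<Prod>w\<in>V. card (S w))" by (rule card_PiE[OF fin])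
  finally have "real (card {f \<in> PiE V (\<lambda>_. {..<M}). \<forall>j\<in>{a..c}. \<forall>w\<in>es j. lo j \<le> f w \<and> f w \<le> hi j})
     \<le> (\<Prod>w\<in>V. real (card (S w)))" by (simp only: of_nat_le_iff flip: of_nat_prod)
  also have "\<dots> = (\<Prod>w\<in>V. real M * h w)" using M by (intro prod.cong) (auto simp: h_def)
  also have "\<dots> = real M ^ card V * prod h V" by (simp add: prod.distrib)
  also have "\<dots> \<le> real M ^ card V * ((1 / real M) ^ (c - a) *
      (\<Prod>j=a..c. (real (hi j + 1 - lo j) / real M) ^ (n - (if j = a then 0 else 1) - (if j = c then 0 else 1))))"
    using hV by (intro mult_left_mono) auto
  finally show ?thesis .
qed

text \<open>AM-GM with an upper bound \<open>m\<close> for the mean: apply t \<le> exp (t - 1) to t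
  = g x / m and multiply; the exponents add up to at most 0.\<close>

lemma prod_le_mean_power:
  fixes g :: "nat \<Rightarrow> real"
  assumes "finite A" "A \<noteq> {}" "\<And>x. x \<in> A \<Longrightarrow> 0 \<le> g x" "sum g A \<le> real (card A) * m" "0 < m"
  shows "prod g A \<le> m ^ card A"
proof -
  have "prod g A \<le> (\<Prod>x\<in>A. m * exp (g x / m - 1))"
  proof (intro prod_mono conjI)
    fix x assume "x \<in> A"
    have "g x / m \<le> exp (g x / m - 1)" using exp_ge_add_one_self[of "g x / m - 1"] by simp
    thus "g x \<le> m * exp (g x / m - 1)" using assms(5) by (simp add: field_simps)
  qed (use assms in auto)
  also have "\<dots> = m ^ card A * exp (sum g A / m - real (card A))"
    using assms(1) by (simp add: prod.distrib exp_sum[symmetric] sum_subtractf sum_divide_distrib)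
  also have "\<dots> \<le> m ^ card A * 1"
    using assms by (intro mult_left_mono) (auto simp: field_simps)
  finally show ?thesis by simp
qed

lemma ex_tie_breaking_key:
  fixes f :: "nat \<Rightarrow> nat"
  assumes "finite V"
  shows "\<exists>\<kappa> :: nat \<Rightarrow> nat. inj_on \<kappa> V \<and> (\<forall>v\<in>V. \<forall>w\<in>V. \<kappa> w \<le> \<kappa> v \<longrightarrow> f w \<le> f v)"
proof -
  obtain B where B: "\<And>v. v \<in> V \<Longrightarrow> v < B"
    using assms by (metis finite_nat_set_iff_bounded)
  \<comment> \<open>Lexicographic order on the pairs (f v, v), coded in base \<open>B\<close>, which
    exceeds every vertex.\<close>
  define \<kappa> where "\<kappa> v = f v * B + v" for v
  have d: "\<kappa> v div B = f v \<and> \<kappa> v mod B = v" if "v \<in> V" for v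
    using B[OF that] by (auto simp: \<kappa>_def)
  have "inj_on \<kappa> V" using d by (metis inj_onI)
  moreover have "f w \<le> f v" if "v \<in> V" "w \<in> V" "\<kappa> w \<le> \<kappa> v" for v w
    using d that by (metis div_le_mono)
  ultimately show ?thesis by blast
qed

section \<open>Gap lengths along a chain\<close>

text \<open>With \<open>chain_high\<close>, the closed range of cells for edge \<open>j\<close> when
  the linking vertices occupy the cells \<open>y\<close>. Ranges of consecutive edges share an
  endpoint, as \<open>card_linked_le\<close> requires; at the two ends of the chain the block
  boundaries take over.\<close>

definition chain_low :: "nat \<Rightarrow> nat \<Rightarrow> nat \<Rightarrow> (nat \<Rightarrow> nat) \<Rightarrow> nat \<Rightarrow> nat" where
  "chain_low D d a y j = (if j = a then a * (D + d) else y (j - 1))"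

definition chain_high :: "nat \<Rightarrow> nat \<Rightarrow> nat \<Rightarrow> (nat \<Rightarrow> nat) \<Rightarrow> nat \<Rightarrow> nat" where
  "chain_high D d c y j = (if j = c then c * (D + d) + D - 1 else y j)"

lemma chain_gap_bounds:
  assumes y: "y \<in> (\<Pi>\<^sub>E j\<in>{a..<c}. late D d j)" and D: "0 < D" and j: "j \<in> {a..c}"
  shows "chain_low D d a y j \<le> j * (D + d)" "j * (D + d) \<le> chain_high D d c y j"
    "chain_low D d a y j + d \<ge> j * (D + d) \<or> j = a"
    "chain_high D d c y j < Suc j * (D + d)" "chain_high D d c y c < c * (D + d) + D"
proof -
  have "j * (D + d) \<le> y (j - 1) + d \<and> y (j - 1) < j * (D + d)" if "j \<noteq> a"
  proof -
    from that j have "j - 1 \<in> {a..<c}" by auto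
    hence "y (j - 1) \<in> late D d (j - 1)" using PiE_mem[OF y] by blast
    moreover obtain i where "j = Suc i" using \<open>j \<noteq> a\<close> j by (cases j) auto
    ultimately show ?thesis by (auto simp: late_def)
  qed
  moreover have "j * (D + d) + D \<le> y j \<and> y j < Suc j * (D + d)" if "j \<noteq> c"
    using y that j by (auto simp: PiE_iff late_def)
  ultimately show "chain_low D d a y j \<le> j * (D + d)" "j * (D + d) \<le> chain_high D d c y j"
    "chain_low D d a y j + d \<ge> j * (D + d) \<or> j = a"
    "chain_high D d c y j < Suc j * (D + d)" "chain_high D d c y c < c * (D + d) + D"
    using D by (auto simp: chain_low_def chain_high_def)
qed

text \<open>The l + 1 ranges cover the cells from a * (D + d) to c * (D + d) + D - 1 and count each
  of the l linking cells twice, so their lengths sum to (l + 1) * D + l * (d + 1). AM-GM bounds the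
  product of all lengths, which enters with power n - 2. The two remaining factors belong to the end
  edges, whose ranges have at most D + d cells.\<close>

lemma chain_gap_prod_le:
  fixes a c D d n :: nat and M :: real
  assumes y: "y \<in> (\<Pi>\<^sub>E j\<in>{a..<c}. late D d j)" and D: "0 < D" and ac: "a \<le> c" and n: "2 \<le> n" and M: "0 < M"
  defines "l \<equiv> c - a"
  shows "(\<Prod>j=a..c. (real (chain_high D d c y j + 1 - chain_low D d a y j) / M)
            ^ (n - (if j = a then 0 else 1) - (if j = c then 0 else 1)))
     \<le> (real (D + d) / M)\<^sup>2 * ((real D + real l * (real d + 1) / (real l + 1)) / M) ^ ((l + 1) * (n - 2))"
proof -
  define x where "x j = real (chain_high D d c y j + 1 - chain_low D d a y j) / M" for j
  have x0: "0 \<le> x j" for j using M by (simp add: x_def)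
  note gb = chain_gap_bounds[OF y D]
  have xa: "x a \<le> real (D + d) / M" using gb(4)[of a] ac M
    by (auto simp: x_def chain_low_def intro!: divide_right_mono)
  have xc: "x c \<le> real (D + d) / M"
  proof (cases "c = a")
    case False
    hence "chain_high D d c y c + 1 - chain_low D d a y c \<le> D + d"
      using gb(3)[of c] gb(5)[of c] ac by auto
    thus ?thesis using M by (simp add: x_def divide_right_mono del: of_nat_add)
  qed (use xa in simp)
  define m where "m = (real D + real l * (real d + 1) / (real l + 1)) / M"
  have m0: "0 < m" using D M by (auto simp: m_def intro!: divide_pos_pos add_pos_nonneg)
  \<comment> \<open>The successive range endpoints, closed off at \<open>Suc c\<close> by the top of
    the last range, so that the sum of lengths telescopes.\<close>
  define Z where "Z j = (if j = Suc c then real (c * (D + d) + D - 1) else real (chain_low D d a y j))" for j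
  have "sum x {a..c} = (\<Sum>j=a..c. (Z (Suc j) - Z j + 1) / M)"
  proof (intro sum.cong refl)
    fix j assume j: "j \<in> {a..c}"
    have "chain_low D d a y j \<le> chain_high D d c y j" using gb(1,2)[OF j] by linarith
    moreover have "Z (Suc j) = real (chain_high D d c y j)" "Z j = real (chain_low D d a y j)"
      using j by (auto simp: Z_def chain_high_def chain_low_def)
    ultimately show "x j = (Z (Suc j) - Z j + 1) / M" by (simp add: x_def of_nat_diff)
  qed
  also have "\<dots> = (\<Sum>j=a..c. Z (Suc j) - Z j + 1) / M" by (simp add: sum_divide_distrib)
  also have "\<dots> = (Z (Suc c) - Z a + real (c + 1 - a)) / M"
    using sum_Suc_diff[of a c Z] ac by (simp add: sum.distrib)
  also have "Z (Suc c) - Z a + real (c + 1 - a) = (real l + 1) * real D + real l * (real d + 1)"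
  proof -
    have c: "c = a + l" using ac by (simp add: l_def)
    have "Z a = real (a * (D + d))" using ac by (simp add: Z_def chain_low_def)
    moreover have "Z (Suc c) = real (c * (D + d) + D) - 1" using D by (simp add: Z_def of_nat_diff)
    ultimately show ?thesis by (simp add: c algebra_simps)
  qed
  also have "\<dots> / M = real (card {a..c}) * m"
  proof -
    have "card {a..c} = l + 1" using ac by (simp add: l_def)
    moreover have "((real l + 1) * real D + real l * (real d + 1)) = (real l + 1) * (m * M)"
    proof -
      have "k * D' + l' * d' = k * ((D' + l' * d' / k) / M * M)" if "k > 0" for k D' l' d' :: real
        using M that by (simp add: field_simps)
      thus ?thesis unfolding m_def by simp
    qed
    ultimately show ?thesis using M by simp
  qed
  finally have "prod x {a..c} \<le> m ^ card {a..c}"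
    using ac x0 m0 by (intro prod_le_mean_power) auto
  also have "card {a..c} = l + 1" using ac by (simp add: l_def)
  finally have px: "prod x {a..c} \<le> m ^ (l + 1)" .
  \<comment> \<open>Each end of the chain spares one linking vertex and so adds one factor; for
    \<open>a = c\<close> the single edge receives both.\<close>
  have "(\<Prod>j=a..c. x j ^ (n - (if j = a then 0 else 1) - (if j = c then 0 else 1)))
      = (\<Prod>j=a..c. x j ^ (n - 2) * (if j = a then x a else 1) * (if j = c then x c else 1))"
  proof (intro prod.cong refl)
    fix j assume "j \<in> {a..c}"
    obtain k where "n = Suc (Suc k)" using n by (metis add_2_eq_Suc le_Suc_ex)
    thus "x j ^ (n - (if j = a then 0 else 1) - (if j = c then 0 else 1))
       = x j ^ (n - 2) * (if j = a then x a else 1) * (if j = c then x c else 1)"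
      by auto
  qed
  also have "\<dots> = prod x {a..c} ^ (n - 2) * x a * x c"
    using ac by (simp add: prod.distrib prod_power_distrib)
  also have "\<dots> \<le> (m ^ (l + 1)) ^ (n - 2) * (real (D + d) / M) * (real (D + d) / M)"
    using px xa xc x0 m0 M by (intro mult_mono power_mono) (auto intro!: prod_nonneg)
  also have "\<dots> = (real (D + d) / M)\<^sup>2 * m ^ ((l + 1) * (n - 2))"
    by (simp only: power2_eq_square power_mult mult_ac)
  finally show ?thesis by (simp only: x_def m_def)
qed

section \<open>The union bound over chains\<close>

text \<open>First moment argument. If no proper colouring existed, every position function would
  give a monochromatic edge and hence realise some chain. For fixed a and c there are at most card E
  ^ (l + 1) edge sequences and d ^ l choices of linking cells, where l = c - a; \<open>small\<close>
  says that the resulting events cannot cover all functions.\<close>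

lemma ex_proper_coloring:
  fixes n r D d :: nat
  assumes H: "uniform_hypergraph n V E" and finE: "finite E" and n: "2 \<le> n" and r: "1 \<le> r" and D: "0 < D"
  defines "M \<equiv> r * D + (r - 1) * d"
  assumes small: "(\<Sum>a<r. \<Sum>c=a..<r. real (card E) ^ (c - a + 1) * (real d / real M) ^ (c - a) *
      ((real (D + d) / real M)\<^sup>2 * ((real D + real (c - a) * (real d + 1) / (real (c - a) + 1)) / real M) ^ ((c - a + 1) * (n - 2)))) < 1"
  shows "\<exists>f. proper_coloring V E r f"
proof (rule ccontr)
  assume no: "\<not> ?thesis"
  have fin: "finite V" and EV: "\<And>e. e \<in> E \<Longrightarrow> e \<subseteq> V" and En: "\<And>e. e \<in> E \<Longrightarrow> card e = n"
    using H by (auto simp: uniform_hypergraph_def)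
  have M0: "0 < M" using D r by (auto simp: M_def)
  have Mr: "M + d = r * (D + d)" using r by (cases r) (auto simp: M_def algebra_simps)
  define \<Omega> where "\<Omega> = (\<Pi>\<^sub>E v\<in>V. {..<M})"
  define ev where "ev a c es y = {f \<in> \<Omega>. \<forall>j\<in>{a..c}. \<forall>w\<in>es j.
      chain_low D d a y j \<le> f w \<and> f w \<le> chain_high D d c y j}" for a c and es :: "nat \<Rightarrow> nat set" and y
  define ES where "ES a c = {es \<in> (\<Pi>\<^sub>E j\<in>{a..c}. E). \<exists>vs. linked a c es vs}" for a c :: nat
  define Y where "Y a c = (\<Pi>\<^sub>E j\<in>{a..<c}. late D d j)" for a c :: nat
  have finY: "finite (Y a c)" for a c
    unfolding Y_def by (simp add: finite_PiE late_def)
  have finES: "finite (ES a c)" for a c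
    unfolding ES_def by (rule finite_subset[of _ "\<Pi>\<^sub>E j\<in>{a..c}. E"]) (auto intro!: finite_PiE finE)
  have fin\<Omega>: "finite \<Omega>" unfolding \<Omega>_def using fin by (intro finite_PiE) auto
  have card\<Omega>: "card \<Omega> = M ^ card V" unfolding \<Omega>_def using fin by (simp add: card_PiE)
  have cover: "\<Omega> \<subseteq> (\<Union>a<r. \<Union>c\<in>{a..<r}. \<Union>es\<in>ES a c. \<Union>y\<in>Y a c. ev a c es y)"
  proof
    fix f assume f: "f \<in> \<Omega>"
    hence fM: "f v < M" if "v \<in> V" for v using that by (auto simp: \<Omega>_def)
    obtain \<kappa> :: "nat \<Rightarrow> nat" where \<kappa>: "inj_on \<kappa> V" and mono0: "\<forall>v\<in>V. \<forall>w\<in>V. \<kappa> w \<le> \<kappa> v \<longrightarrow> f w \<le> f v"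
      using ex_tie_breaking_key[OF fin, of f] by blast
    have mono: "f w \<le> f v" if "v \<in> V" "w \<in> V" "\<kappa> w \<le> \<kappa> v" for v w
      using mono0 that by blast
    define col where "col = bump_coloring V E D d f \<kappa>"
    \<comment> \<open>All positions lie below M, where block r - 1 ends without late cells, so a
      raised vertex comes from block r - 2 or earlier.\<close>
    have col_r: "col v < r" if v: "v \<in> V" for v
    proof -
      have lt: "f v + d < r * (D + d)" using fM[OF v] Mr by linarith
      hence *: "f v div (D + d) < r" by (simp add: less_mult_imp_div_less)
      have "Suc (f v div (D + d)) < r" if "v \<in> bumped V E D d f \<kappa> (Suc (f v div (D + d)))"
      proof -
        have "f v \<in> late D d (f v div (D + d))" using that by (rule bumped_late)
        hence "Suc (f v div (D + d)) * (D + d) \<le> f v + d" by (simp add: late_def)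
        hence "Suc (f v div (D + d)) * (D + d) < r * (D + d)" using lt by linarith
        thus ?thesis using mult_less_cancel2 by blast
      qed
      thus ?thesis using * by (simp add: col_def bump_coloring_def Let_def)
    qed
    obtain e c where e: "e \<in> E" "\<And>v. v \<in> e \<Longrightarrow> col v = c"
    proof -
      have "\<not> proper_coloring V E r col" using no by blast
      thus ?thesis using col_r that unfolding proper_coloring_def by blast
    qed
    have ne: "e \<noteq> {}" using En[OF e(1)] n by auto
    obtain a es vs where ch: "edge_chain E D d f \<kappa> a c es vs" and
      top: "\<And>w. w \<in> es c \<Longrightarrow> f w < c * (D + d) + D"
    proof -
      have "\<exists>a es vs. edge_chain E D d f \<kappa> a c es vs \<and> (\<forall>w\<in>es c. f w < c * (D + d) + D)"
        using EV fin mono e(1) ne D e(2)[unfolded col_def]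
        by (rule edge_chain_if_monochromatic[where \<kappa> = \<kappa> and f = f])
      thus ?thesis using that by blast
    qed
    have lk: "linked a c es vs" 
      using EV \<kappa> mono ch by (rule linked_edge_chain[where \<kappa> = \<kappa> and f = f])
    have ac: "a \<le> c" using ch by (simp add: edge_chain_def)
    have cr: "c < r" using e ne EV col_r by (metis all_not_in_conv subsetD)
    \<comment> \<open>Restricting makes the chain data elements of the finite extensional function
      spaces over which the union runs.\<close>
    define es' where "es' = restrict es {a..c}"
    define y where "y = restrict (\<lambda>j. f (vs j)) {a..<c}"
    have "linked a c es' vs" using lk by (auto simp: linked_def es'_def)
    hence "es' \<in> ES a c" using ch by (auto simp: ES_def es'_def edge_chain_def)
    moreover have "y \<in> Y a c" using ch by (auto simp: Y_def y_def edge_chain_def)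
    moreover have "f \<in> ev a c es' y"
    proof -
      have "chain_low D d a y j \<le> f w \<and> f w \<le> chain_high D d c y j"
        if j: "j \<in> {a..c}" and w: "w \<in> es' j" for j w
      proof -
        have w': "w \<in> es j" using w j by (simp add: es'_def)
        have V: "u \<in> V" if "i \<in> {a..c}" "u \<in> es i" for i u
          using that ch EV by (meson edge_chain_def subsetD)
        have "chain_low D d a y j \<le> f w"
        proof (cases "j = a")
          case True
          thus ?thesis using ch w' by (simp add: chain_low_def edge_chain_def)
        next
          case False
          then obtain i where i: "j = Suc i" "i \<in> {a..<c}" using j by (cases j) auto
          have "\<kappa> (vs i) \<le> \<kappa> w" "vs i \<in> es i" using ch i w' by (auto simp: edge_chain_def)
          hence "f (vs i) \<le> f w" using mono V[of i "vs i"] V[OF j w'] i by simp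
          thus ?thesis using i False by (simp add: chain_low_def y_def)
        qed
        moreover have "f w \<le> chain_high D d c y j"
        proof (cases "j = c")
          case True
          thus ?thesis using top w' by (fastforce simp: chain_high_def)
        next
          case False
          hence i: "j \<in> {a..<c}" using j by auto
          have "\<kappa> w \<le> \<kappa> (vs j)" "vs j \<in> es j" using ch i w' by (auto simp: edge_chain_def)
          hence "f w \<le> f (vs j)" using mono V[of j "vs j"] V[OF j w'] j by simp
          thus ?thesis using i by (simp add: chain_high_def y_def)
        qed
        ultimately show ?thesis ..
      qed
      thus ?thesis using f by (simp add: ev_def)
    qed
    ultimately show "f \<in> (\<Union>a<r. \<Union>c\<in>{a..<r}. \<Union>es\<in>ES a c. \<Union>y\<in>Y a c. ev a c es y)"
      using ac cr by force
  qed
  define P where "P a c = (real (D + d) / real M)\<^sup>2 *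
     ((real D + real (c - a) * (real d + 1) / (real (c - a) + 1)) / real M) ^ ((c - a + 1) * (n - 2))" for a c
  have P0: "0 \<le> P a c" for a c by (simp add: P_def)
  have ev_le: "real (card (ev a c es y)) \<le> real M ^ card V * ((1 / real M) ^ (c - a) * P a c)"
    if ac: "a \<le> c" "c < r" and es: "es \<in> ES a c" and y: "y \<in> Y a c" for a c es y
  proof -
    obtain vs where lk: "linked a c es vs" using es by (auto simp: ES_def)
    have esE: "es j \<in> E" if "j \<in> {a..c}" for j using es that by (auto simp: ES_def)
    note y' = y[unfolded Y_def]
    have hM: "chain_high D d c y j < M" if j: "j \<in> {a..c}" for j
    proof -
      have top: "c * (D + d) + D \<le> M"
      proof -
        have "Suc c * (D + d) \<le> r * (D + d)" using ac by (intro mult_right_mono) auto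
        thus ?thesis using Mr by simp
      qed
      show ?thesis
      proof (cases "j = c")
        case True
        thus ?thesis using chain_gap_bounds(5)[OF y' D j] top by simp
      next
        case False
        hence "Suc j * (D + d) \<le> c * (D + d)" using j by (intro mult_right_mono) auto
        thus ?thesis using chain_gap_bounds(4)[OF y' D j] top by linarith
      qed
    qed
    have "real (card (ev a c es y)) \<le> real M ^ card V * ((1 / real M) ^ (c - a) *
        (\<Prod>j=a..c. (real (chain_high D d c y j + 1 - chain_low D d a y j) / real M)
            ^ (n - (if j = a then 0 else 1) - (if j = c then 0 else 1))))"
      unfolding ev_def \<Omega>_def
    proof (rule card_linked_le[OF fin M0 ac(1) _ lk])
      show "es j \<subseteq> V \<and> card (es j) = n" if "j \<in> {a..c}" for j
        using esE[OF that] EV En by blast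
      show "chain_high D d c y j = chain_low D d a y (Suc j)" if "j \<in> {a..<c}" for j
        using that by (simp add: chain_high_def chain_low_def)
      show "chain_low D d a y j \<le> chain_high D d c y j \<and> chain_high D d c y j < M" if "j \<in> {a..c}" for j
        using hM[OF that] chain_gap_bounds(1,2)[OF y' D that] by linarith
    qed
    also have "\<dots> \<le> real M ^ card V * ((1 / real M) ^ (c - a) * P a c)"
      unfolding P_def using chain_gap_prod_le[OF y' D ac(1) n, of "real M"] M0
      by (intro mult_left_mono) auto
    finally show ?thesis .
  qed
  have cardES: "card (ES a c) \<le> card E ^ (c - a + 1)" if "a \<le> c" for a c
  proof -
    have "card (ES a c) \<le> card (\<Pi>\<^sub>E j\<in>{a..c}. E)"
      unfolding ES_def by (intro card_mono finite_PiE finE) (auto simp: finE)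
    also have "\<dots> = card E ^ (c - a + 1)" using that by (simp add: card_PiE Suc_diff_le)
    finally show ?thesis .
  qed
  have cardY: "card (Y a c) = d ^ (c - a)" for a c
    by (simp add: Y_def card_PiE late_def)
  have "real M ^ card V = real (card \<Omega>)" by (simp add: card\<Omega>)
  also have "real (card \<Omega>) \<le> real (card (\<Union>a<r. \<Union>c\<in>{a..<r}. \<Union>es\<in>ES a c. \<Union>y\<in>Y a c. ev a c es y))"
    using cover finES finY fin\<Omega> by (intro of_nat_mono card_mono) (auto simp: ev_def)
  also have "\<dots> \<le> (\<Sum>a<r. \<Sum>c=a..<r. \<Sum>es\<in>ES a c. \<Sum>y\<in>Y a c. real (card (ev a c es y)))"
  proof -
    have "card (\<Union>a<r. \<Union>c\<in>{a..<r}. \<Union>es\<in>ES a c. \<Union>y\<in>Y a c. ev a c es y)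
       \<le> (\<Sum>a<r. \<Sum>c=a..<r. \<Sum>es\<in>ES a c. \<Sum>y\<in>Y a c. card (ev a c es y))"
      using finES finY by (intro order.trans[OF card_UN_le] sum_mono order.refl) auto
    thus ?thesis by (simp only: of_nat_le_iff flip: of_nat_sum)
  qed
  also have "\<dots> \<le> (\<Sum>a<r. \<Sum>c=a..<r. real M ^ card V * (real (card E) ^ (c - a + 1) * (real d / real M) ^ (c - a) * P a c))"
  proof (intro sum_mono)
    fix a c assume "a \<in> {..<r}" "c \<in> {a..<r}"
    hence ac: "a \<le> c" "c < r" by auto
    have "(\<Sum>es\<in>ES a c. \<Sum>y\<in>Y a c. real (card (ev a c es y)))
       \<le> (\<Sum>es\<in>ES a c. \<Sum>y\<in>Y a c. real M ^ card V * ((1 / real M) ^ (c - a) * P a c))"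
      using ev_le[OF ac] by (intro sum_mono) auto
    also have "\<dots> = real (card (ES a c)) * (real d ^ (c - a) * (real M ^ card V * ((1 / real M) ^ (c - a) * P a c)))"
      by (simp add: cardY)
    also have "\<dots> \<le> real (card E ^ (c - a + 1)) * (real d ^ (c - a) * (real M ^ card V * ((1 / real M) ^ (c - a) * P a c)))"
      using cardES[OF ac(1)] P0 by (intro mult_right_mono of_nat_mono) auto
    also have "\<dots> = real M ^ card V * (real (card E) ^ (c - a + 1) * (real d / real M) ^ (c - a) * P a c)"
      by (simp add: power_divide)
    finally show "(\<Sum>es\<in>ES a c. \<Sum>y\<in>Y a c. real (card (ev a c es y)))
       \<le> real M ^ card V * (real (card E) ^ (c - a + 1) * (real d / real M) ^ (c - a) * P a c)" .
  qed
  also have "\<dots> = real M ^ card V * (\<Sum>a<r. \<Sum>c=a..<r. real (card E) ^ (c - a + 1) * (real d / real M) ^ (c - a) * P a c)"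
    by (simp add: sum_distrib_left)
  also have "\<dots> < real M ^ card V * 1"
    using small M0 unfolding P_def by (intro mult_strict_left_mono) auto
  finally show False by simp
qed

section \<open>Extremal hypergraphs and the minimum m(n, r)\<close>

text \<open>Pigeonhole in the complete n-uniform hypergraph on r * (n - 1) + 1 vertices: in a proper
  colouring every colour class has at most n - 1 vertices.\<close>

lemma ex_high_chromatic:
  assumes n: "2 \<le> n"
  shows "\<exists>V E. uniform_hypergraph n V E \<and> finite E \<and> chromatic_number V E > r"
proof -
  define V where "V = {..r * (n - 1)}"
  define E where "E = {e. e \<subseteq> V \<and> card e = n}"
  have "uniform_hypergraph n V E" by (auto simp: uniform_hypergraph_def V_def E_def)
  moreover have "finite E" unfolding E_def by (rule finite_subset[of _ "Pow V"]) (auto simp: V_def)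
  moreover have "chromatic_number V E > r"
  proof (rule ccontr)
    define k where "k = chromatic_number V E"
    assume "\<not> chromatic_number V E > r"
    hence k: "k \<le> r" by (simp add: k_def)
    have "\<not> (\<forall>v\<in>e. id v = c)" if "e \<in> E" for e c
    proof
      assume *: "\<forall>v\<in>e. id v = c"
      hence "e \<subseteq> {c}" by auto
      hence "card e \<le> 1" using card_mono[of "{c}" e] by simp
      thus False using that n by (simp add: E_def)
    qed
    \<comment> \<open>The injective colouring is proper since edges have at least two vertices; such
      a witness is needed for the \<open>LEAST\<close> in \<open>chromatic_number\<close> to be
      attained.\<close>
    hence "\<exists>f. proper_coloring V E (Suc (r * (n - 1))) f"
      unfolding proper_coloring_def by (intro exI[of _ id]) (auto simp: V_def)
    hence "\<exists>f. proper_coloring V E k f" unfolding k_def chromatic_number_def by (rule LeastI[where P = "\<lambda>k. \<exists>f. proper_coloring V E k f"])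
    then obtain f where f: "proper_coloring V E k f" ..
    have cl: "card {v \<in> V. f v = c} \<le> n - 1" for c
    proof (rule ccontr)
      assume "\<not> ?thesis"
      hence "n \<le> card {v \<in> V. f v = c}" by simp
      from obtain_subset_with_card_n[OF this]
      obtain e where "e \<subseteq> {v \<in> V. f v = c}" "card e = n" by blast
      hence "e \<in> E" "\<forall>v\<in>e. f v = c" by (auto simp: E_def)
      thus False using f unfolding proper_coloring_def by blast
    qed
    have "card V \<le> card (\<Union>c<k. {v \<in> V. f v = c})"
      using f by (intro card_mono) (auto simp: proper_coloring_def V_def)
    also have "\<dots> \<le> (\<Sum>c<k. card {v \<in> V. f v = c})" by (rule card_UN_le) simp
    also have "\<dots> \<le> k * (n - 1)" using sum_bounded_above[of "{..<k}" "\<lambda>c. card {v \<in> V. f v = c}" "n - 1"] cl by simp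
    also have "\<dots> \<le> r * (n - 1)" using k by simp
    finally show False by (simp add: V_def)
  qed
  ultimately show ?thesis by blast
qed

lemma m_hyp_attained:
  assumes "2 \<le> n"
  obtains V E where "uniform_hypergraph n V E" "finite E" "card E = m_hyp n r"
    "\<And>f. \<not> proper_coloring V E r f"
proof -
  have "\<exists>k V E. uniform_hypergraph n V E \<and> finite E \<and> chromatic_number V E > r \<and> card E = k"
    using ex_high_chromatic[OF assms, of r] by blast
  hence "\<exists>V E. uniform_hypergraph n V E \<and> finite E \<and> chromatic_number V E > r \<and> card E = m_hyp n r"
    unfolding m_hyp_def by (rule LeastI_ex)
  then obtain V E where VE: "uniform_hypergraph n V E" "finite E" "chromatic_number V E > r" "card E = m_hyp n r"
    by blast
  have "\<not> proper_coloring V E r f" for f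
    using VE(3) Least_le[of "\<lambda>r. \<exists>f. proper_coloring V E r f" r]
    unfolding chromatic_number_def by (metis leD)
  thus ?thesis using that VE by blast
qed

section \<open>Comparison of q'(r) with r^(1/r)\<close>

text \<open>The induction step rests on (r + 1) * (r - 1) \<le> r^2.\<close>

lemma fact_le_two_power:
  assumes "2 \<le> r"
  shows "(fact r :: real) \<le> 2 * (real r - 1) ^ (r - 1)"
  using assms
proof (induction r rule: nat_induct_at_least)
  case base
  thus ?case by (simp add: fact_numeral)
next
  case (Suc r)
  obtain k where k: "r = Suc (Suc k)" using Suc by (metis add_2_eq_Suc le_Suc_ex)
  have "(fact (Suc r) :: real) = (real r + 1) * fact r" by simp
  also have "\<dots> \<le> (real r + 1) * (2 * (real r - 1) ^ (r - 1))"
    using Suc by (intro mult_left_mono) auto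
  also have "\<dots> = 2 * ((real r)\<^sup>2 - 1) * (real r - 1) ^ k"
    by (simp add: k power2_eq_square algebra_simps)
  also have "\<dots> \<le> 2 * (real r)\<^sup>2 * real r ^ k"
    by (intro mult_mono power_mono) (auto simp: k)
  also have "\<dots> = 2 * (real (Suc r) - 1) ^ (Suc r - 1)"
    by (simp add: k power2_eq_square)
  finally show ?case .
qed

text \<open>Taking r-th powers and clearing the denominator \<open>Z\<close> of \<open>q' r\<close>
  turns the claim into \<open>fact_le_two_power\<close>, because r * Z^r = 2 * (r - 1)^(r -
  1).\<close>

lemma q'_le:
  assumes r: "2 \<le> r"
  shows "q' r \<le> real r powr (1 / real r)"
proof -
  define R where "R = real r"
  have R: "2 \<le> R" using r by (simp add: R_def)
  define Z where "Z = (2 * (1 - 1 / R) ^ (r - 1) * R ^ (r - 2)) powr (1 / R)"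
  have Z: "Z = 2 powr (1 / R) * (1 - 1 / R) powr ((R - 1) / R) * R powr ((R - 2) / R)"
  proof -
    have "(1 - 1 / R) ^ (r - 1) = (1 - 1 / R) powr (R - 1)"
      using R r by (subst powr_realpow[symmetric]) (auto simp: R_def of_nat_diff)
    moreover have "R ^ (r - 2) = R powr (R - 2)"
      using R r by (subst powr_realpow[symmetric]) (auto simp: R_def of_nat_diff)
    ultimately show ?thesis using R by (simp add: Z_def powr_mult powr_powr)
  qed
  have Zpos: "0 < Z" using R by (simp add: Z)
  obtain k where k: "r = Suc (Suc k)" using r by (metis add_2_eq_Suc le_Suc_ex)
  have "R * (2 * (1 - 1 / R) ^ (r - 1) * R ^ (r - 2)) = 2 * (R - 1) ^ (r - 1)"
  proof -
    have "(R - 1) ^ (r - 1) = (R * (1 - 1 / R)) ^ (r - 1)" using R by (simp add: right_diff_distrib)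
    also have "\<dots> = R * R ^ k * (1 - 1 / R) ^ (r - 1)" by (simp only: power_mult_distrib) (simp add: k)
    finally show ?thesis by (simp add: k)
  qed
  hence "(fact r :: real) \<le> R * (2 * (1 - 1 / R) ^ (r - 1) * R ^ (r - 2))"
    using fact_le_two_power[OF r] by (simp add: R_def)
  hence "(fact r :: real) powr (1 / R) \<le> (R * (2 * (1 - 1 / R) ^ (r - 1) * R ^ (r - 2))) powr (1 / R)"
    using R by (intro powr_mono2) auto
  also have "\<dots> = R powr (1 / R) * Z" using R by (simp add: Z_def powr_mult)
  finally have "(fact r :: real) powr (1 / R) / Z \<le> R powr (1 / R)"
    using Zpos by (simp add: divide_le_eq)
  thus ?thesis by (simp add: q'_def Z R_def)
qed

section \<open>Estimating the sum over chains\<close>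

text \<open>
  Here \<open>\<theta> = n / M\<close> is the proportion of cells in a late part; \<open>\<gamma> * L * r * \<theta> \<le> 1\<close> balances the number of
  placements of the linking vertices against the number of edges.
\<close>

lemma chain_term_le:
  fixes n r k l :: nat and \<gamma> L u N :: real
  assumes n: "2 \<le> n" and r: "2 \<le> r" and k: "1 \<le> k" and l: "l < r"
    and pos: "0 < \<gamma>" "0 < L" "0 < u" and ur: "u ^ r = L / real r"
    and N: "0 \<le> N" "N \<le> \<gamma> * (L / u) * real r ^ (n - 1)"
  defines "\<theta> \<equiv> 1 / (real r * (real k + 1) - 1)"
    and "D \<equiv> k * n"
  defines "M \<equiv> r * D + (r - 1) * n"
  assumes \<theta>: "\<gamma> * L * real r * \<theta> \<le> 1"
  shows "N ^ (l + 1) * (real n / real M) ^ l *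
      ((real (D + n) / real M)\<^sup>2 * ((real D + real l * (real n + 1) / (real l + 1)) / real M) ^ ((l + 1) * (n - 2)))
     \<le> \<gamma> * exp (2 * real r / (\<gamma> * L)) * (u * exp (- real n * \<theta>)) ^ (r - 1 - l)"
proof -
  define R where "R = real r"
  \<comment> \<open>The number of blocks not met by a chain of l + 1 edges.\<close>
  define s where "s = r - 1 - l"
  have R: "2 \<le> R" using r by (simp add: R_def)
  have s: "real s = R - 1 - real l" using l by (simp add: s_def R_def of_nat_diff)
  have den: "0 < R * (real k + 1) - 1"
  proof -
    have "2 * 1 \<le> R * (real k + 1)" using R by (intro mult_mono) auto
    thus ?thesis by simp
  qed
  have \<theta>0: "0 < \<theta>" using den by (simp add: \<theta>_def R_def)
  have \<theta>1: "\<theta> * (R * (real k + 1) - 1) = 1" using den by (simp add: \<theta>_def R_def)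
  have M: "real M = real n / \<theta>"
  proof -
    have "real M = real n * (R * (real k + 1) - 1)"
      using r by (cases r) (simp_all add: M_def D_def R_def algebra_simps)
    thus ?thesis using den by (simp add: \<theta>_def R_def)
  qed
  have n0: "0 < real n" using n by simp
  have nM: "real n / real M = \<theta>" using n0 by (simp add: M)
  have DM: "real D / real M = (1 - (R - 1) * \<theta>) / R"
  proof -
    have "real D / real M = real k * \<theta>" using n0 by (simp add: M D_def)
    moreover have "1 - (R - 1) * \<theta> = R * (real k * \<theta>)" using \<theta>1 by (simp add: algebra_simps)
    ultimately show ?thesis using R by simp
  qed
  have first: "(real (D + n) / real M)\<^sup>2 \<le> exp (2 * \<theta>) / R\<^sup>2"
  proof -
    have "real (D + n) / real M = (1 + \<theta>) / R" using R
      by (simp add: add_divide_distrib nM DM) (simp add: field_simps)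
    also have "\<dots> \<le> exp \<theta> / R" using R exp_ge_add_one_self[of \<theta>] by (simp add: divide_right_mono)
    finally have "(real (D + n) / real M)\<^sup>2 \<le> (exp \<theta> / R)\<^sup>2" by (intro power_mono) auto
    also have "\<dots> = exp (2 * \<theta>) / R\<^sup>2" by (simp add: power_divide exp_double)
    finally show ?thesis .
  qed
  define m where "m = (real D + real l * (real n + 1) / (real l + 1)) / real M"
  have m0: "0 \<le> m" by (simp add: m_def)
  \<comment> \<open>The mean range length relative to M: 1 / R, reduced in proportion to the
    \<open>s\<close> missing blocks, plus a small term from counting linking cells twice.\<close>
  have "m = (1 - real s * \<theta> / (real l + 1) + R * real l / (real l + 1) * \<theta> / real n) / R"
  proof -
    have id: "(1 - (R - 1) * \<theta>) / R + (t - 1) * (\<theta> + z) / t = (1 - (R - t) * \<theta> / t + R * (t - 1) / t * z) / R"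
      if "0 < t" for t z
      using that R by (simp add: field_simps)
    have "m = real D / real M + real l * (real n / real M + 1 / real M) / (real l + 1)"
    proof -
      have "(a + b * (p + 1) / t) / q = a / q + b * (p / q + 1 / q) / t" for a b p q t :: real
        by (cases "t = 0"; cases "q = 0") (auto simp: field_simps)
      thus ?thesis by (simp only: m_def)
    qed
    also have "1 / real M = \<theta> / real n" using n0 by (simp add: M)
    finally have "m = (1 - (R - 1) * \<theta>) / R + real l * (\<theta> + \<theta> / real n) / (real l + 1)"
      by (simp only: DM nM)
    also have "\<dots> = (1 - (R - (real l + 1)) * \<theta> / (real l + 1) + R * real l / (real l + 1) * (\<theta> / real n)) / R"
      using id[of "real l + 1" "\<theta> / real n"] by simp
    also have "R - (real l + 1) = real s" by (simp add: s)
    finally show ?thesis by simp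
  qed
  also have "\<dots> \<le> exp (- real s * \<theta> / (real l + 1) + R * \<theta> / real n) / R"
  proof -
    have "R * (real l / (real l + 1)) * (\<theta> / real n) \<le> R * 1 * (\<theta> / real n)"
      using R \<theta>0 by (intro mult_mono) auto
    hence "1 - real s * \<theta> / (real l + 1) + R * real l / (real l + 1) * \<theta> / real n
       \<le> 1 + (- real s * \<theta> / (real l + 1) + R * \<theta> / real n)" by simp
    also have "\<dots> \<le> exp (- real s * \<theta> / (real l + 1) + R * \<theta> / real n)" by (rule exp_ge_add_one_self)
    finally show ?thesis using R by (intro divide_right_mono) auto
  qed
  finally have m: "m \<le> exp (- real s * \<theta> / (real l + 1) + R * \<theta> / real n) / R" .
  define w where "w = (l + 1) * (n - 2)"
  have "m ^ w \<le> (exp (- real s * \<theta> / (real l + 1) + R * \<theta> / real n) / R) ^ w"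
    using m m0 by (rule power_mono)
  also have "\<dots> = exp (real w * (- real s * \<theta> / (real l + 1) + R * \<theta> / real n)) / R ^ w"
    by (simp only: power_divide exp_of_nat_mult)
  \<comment> \<open>Having n - 2 in place of n in the exponent costs exp (2 * \<theta> * s), and the
    doubly counted cells cost at most exp (R^2 * \<theta>).\<close>
  also have "\<dots> \<le> exp (- real n * \<theta> * real s + 2 * \<theta> * real s + R\<^sup>2 * \<theta>) / R ^ w"
  proof -
    have w: "real w = (real l + 1) * (real n - 2)" using n unfolding w_def by (simp only: of_nat_mult of_nat_diff of_nat_add of_nat_1 of_nat_numeral)
    have "real w * (- real s * \<theta> / (real l + 1)) = - real n * \<theta> * real s + 2 * \<theta> * real s"
      unfolding w by (simp add: field_simps)
    moreover have "real w * (R * \<theta> / real n) \<le> R * real n * (R * \<theta> / real n)"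
    proof (intro mult_right_mono)
      have "real l + 1 \<le> R" using l by (simp add: R_def)
      thus "real w \<le> R * real n" unfolding w using n R by (intro mult_mono) auto
    qed (use R \<theta>0 in auto)
    moreover have "R * real n * (R * \<theta> / real n) = R\<^sup>2 * \<theta>" using n0 by (simp add: power2_eq_square)
    ultimately have "real w * (- real s * \<theta> / (real l + 1) + R * \<theta> / real n)
      \<le> - real n * \<theta> * real s + 2 * \<theta> * real s + R\<^sup>2 * \<theta>" by (simp only: distrib_left)
    thus ?thesis using R by (intro divide_right_mono) auto
  qed
  finally have second: "m ^ w \<le> exp (- real n * \<theta> * real s + 2 * \<theta> * real s + R\<^sup>2 * \<theta>) / R ^ w" .
  have "N ^ (l + 1) * \<theta> ^ l * ((real (D + n) / real M)\<^sup>2 * m ^ w)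
     \<le> (\<gamma> * (L / u) * R ^ (n - 1)) ^ (l + 1) * \<theta> ^ l *
        (exp (2 * \<theta>) / R\<^sup>2 * (exp (- real n * \<theta> * real s + 2 * \<theta> * real s + R\<^sup>2 * \<theta>) / R ^ w))"
    using N first second m0 \<theta>0 R pos
    by (intro mult_mono power_mono) (auto simp: R_def)
  \<comment> \<open>All powers of \<open>R\<close> cancel except those paired with \<theta>. Since L
    = R * u^r, the factor L / u^(l + 1) equals R * u^s; this is where the excess u^s comes
    from.\<close>
  also have "\<dots> = \<gamma> * (\<gamma> * L * R * \<theta>) ^ l * u ^ s * exp (2 * \<theta> + (- real n * \<theta> * real s + 2 * \<theta> * real s + R\<^sup>2 * \<theta>))"
  proof -
    have e1: "(R ^ (n - 1)) ^ (l + 1) = R ^ w * R ^ l * R"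
    proof -
      obtain m where "n = 2 + m" using n le_Suc_ex by blast
      hence "(n - 1) * (l + 1) = w + (l + 1)" by (simp add: w_def)
      hence "(R ^ (n - 1)) ^ (l + 1) = R ^ (w + (l + 1))" by (simp only: flip: power_mult)
      thus ?thesis by (simp add: power_add)
    qed
    have e2: "L = R * (u ^ s * u ^ (l + 1))"
    proof -
      have "r = s + (l + 1)" using l by (simp add: s_def)
      hence "u ^ r = u ^ s * u ^ (l + 1)" by (metis power_add)
      moreover have "L = R * u ^ r" using ur R by (simp add: R_def)
      ultimately show ?thesis by (simp only:)
    qed
    have "(\<gamma> * (L / u) * R ^ (n - 1)) ^ (l + 1) = \<gamma> * \<gamma> ^ l * (L * L ^ l) / u ^ (l + 1) * (R ^ w * R ^ l * R)"
      by (simp only: power_mult_distrib power_divide e1) simp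
    also have "\<dots> = \<gamma> * \<gamma> ^ l * (R * u ^ s * L ^ l) * (R ^ w * R ^ l * R)"
      using e2 pos(3) by simp
    finally have e3: "(\<gamma> * (L / u) * R ^ (n - 1)) ^ (l + 1) = \<gamma> * \<gamma> ^ l * (R * u ^ s * L ^ l) * (R ^ w * R ^ l * R)" .
    have "\<gamma> * \<gamma> ^ l * (R * u ^ s * L ^ l) * (R ^ w * R ^ l * R) * \<theta> ^ l * (exp x / R\<^sup>2 * (exp y / R ^ w))
        = \<gamma> * (\<gamma> * L * R * \<theta>) ^ l * u ^ s * exp (x + y)" for x y
      using R by (simp add: power_mult_distrib exp_add power2_eq_square)
    thus ?thesis by (simp only: e3)
  qed
  \<comment> \<open>The error exponents add up to at most 2 * R^2 * \<theta>, and R * \<theta> \<le>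
    1 / (\<gamma> * L) by the balance condition.\<close>
  also have "\<dots> \<le> \<gamma> * 1 * u ^ s * exp (2 * R / (\<gamma> * L) - real n * \<theta> * real s)"
  proof -
    have "\<theta> * (2 + 2 * real s) \<le> \<theta> * (R * R)"
    proof (intro mult_left_mono)
      have "2 * R \<le> R * R" using R by (intro mult_right_mono) auto
      thus "2 + 2 * real s \<le> R * R" by (simp add: s)
    qed (use \<theta>0 in simp)
    hence "2 * \<theta> + 2 * \<theta> * real s + R\<^sup>2 * \<theta> \<le> 2 * R * (R * \<theta>)"
      by (simp add: power2_eq_square algebra_simps)
    also have "\<dots> \<le> 2 * R * (1 / (\<gamma> * L))"
      using \<theta> pos R by (intro mult_left_mono) (auto simp: R_def field_simps)
    finally have "2 * \<theta> + (- real n * \<theta> * real s + 2 * \<theta> * real s + R\<^sup>2 * \<theta>) \<le> 2 * R / (\<gamma> * L) - real n * \<theta> * real s"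
      by simp
    moreover have "(\<gamma> * L * R * \<theta>) ^ l \<le> 1"
      using \<theta> pos \<theta>0 R by (intro power_le_one) (auto simp: R_def)
    ultimately show ?thesis using pos R \<theta>0 by (intro mult_mono) auto
  qed
  also have "\<dots> = \<gamma> * exp (2 * R / (\<gamma> * L)) * (u * exp (- real n * \<theta>)) ^ s"
    by (simp add: power_mult_distrib exp_of_nat_mult[symmetric] exp_diff exp_minus field_simps)
  finally show ?thesis by (simp only: nM m_def w_def s_def R_def)
qed

lemma sum_power_le_inverse:
  fixes x :: real
  assumes "0 \<le> x" "x < 1"
  shows "(\<Sum>i<r. x ^ i) \<le> 1 / (1 - x)"
  using assms sum_le_suminf[of "\<lambda>i. x ^ i" "{..<r}"] summable_geometric[of x] suminf_geometric[of x] by simp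

text \<open>For a chain from a to c the number of missing blocks is a + (r - 1 - c), so the bound of
  \<open>chain_term_le\<close> splits into a factor for each end, and the sum over chains is at most
  a constant times the square of a geometric series in \<rho>.\<close>

lemma ex_proper_coloring_few_edges:
  fixes n r k :: nat and \<gamma> L u \<rho> :: real
  assumes H: "uniform_hypergraph n V E" and finE: "finite E"
    and n: "2 \<le> n" and r: "2 \<le> r" and k: "1 \<le> k"
    and pos: "0 < \<gamma>" "0 < L" "0 < u" and ur: "u ^ r = L / real r"
    and N: "real (card E) \<le> \<gamma> * (L / u) * real r ^ (n - 1)"
  defines "\<theta> \<equiv> 1 / (real r * (real k + 1) - 1)"
  assumes \<theta>: "\<gamma> * L * real r * \<theta> \<le> 1"
    and \<rho>: "u * exp (- real n * \<theta>) \<le> \<rho>" "\<rho> < 1" "\<gamma> * exp (2 * real r / (\<gamma> * L)) < (1 - \<rho>)\<^sup>2"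
  shows "\<exists>f. proper_coloring V E r f"
proof -
  define M where "M = r * (k * n) + (r - 1) * n"
  define C where "C = \<gamma> * exp (2 * real r / (\<gamma> * L))"
  have C0: "0 \<le> C" using pos by (simp add: C_def)
  have \<rho>0: "0 \<le> \<rho>" using \<rho>(1) pos(3) by (smt (verit) exp_gt_zero mult_pos_pos)
  have "(\<Sum>a<r. \<Sum>c=a..<r. real (card E) ^ (c - a + 1) * (real n / real M) ^ (c - a) *
      ((real (k * n + n) / real M)\<^sup>2 * ((real (k * n) + real (c - a) * (real n + 1) / (real (c - a) + 1)) / real M) ^ ((c - a + 1) * (n - 2))))
     \<le> (\<Sum>a<r. \<Sum>c=a..<r. C * (\<rho> ^ a * \<rho> ^ (r - 1 - c)))"
  proof (intro sum_mono)
    fix a c assume "a \<in> {..<r}" "c \<in> {a..<r}"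
    hence ac: "a \<le> c" "c - a < r" "r - 1 - (c - a) = a + (r - 1 - c)" by auto
    have "real (card E) ^ (c - a + 1) * (real n / real M) ^ (c - a) *
      ((real (k * n + n) / real M)\<^sup>2 * ((real (k * n) + real (c - a) * (real n + 1) / (real (c - a) + 1)) / real M) ^ ((c - a + 1) * (n - 2)))
      \<le> C * (u * exp (- real n * \<theta>)) ^ (r - 1 - (c - a))"
      unfolding M_def C_def \<theta>_def
      by (rule chain_term_le[OF n r k ac(2) pos ur _ N \<theta>[unfolded \<theta>_def]]) simp
    also have "\<dots> \<le> C * \<rho> ^ (r - 1 - (c - a))"
      using \<rho>(1) C0 pos by (intro mult_left_mono power_mono) auto
    also have "\<dots> = C * (\<rho> ^ a * \<rho> ^ (r - 1 - c))" by (simp only: ac(3) power_add)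
    finally show "real (card E) ^ (c - a + 1) * (real n / real M) ^ (c - a) *
      ((real (k * n + n) / real M)\<^sup>2 * ((real (k * n) + real (c - a) * (real n + 1) / (real (c - a) + 1)) / real M) ^ ((c - a + 1) * (n - 2)))
      \<le> C * (\<rho> ^ a * \<rho> ^ (r - 1 - c))" .
  qed
  \<comment> \<open>Dropping the constraint a \<le> c makes the double sum a product.\<close>
  also have "\<dots> \<le> (\<Sum>a<r. \<Sum>c<r. C * (\<rho> ^ a * \<rho> ^ (r - 1 - c)))"
    using C0 \<rho>0 by (intro sum_mono sum_mono2) auto
  also have "\<dots> = C * ((\<Sum>a<r. \<rho> ^ a) * (\<Sum>c<r. \<rho> ^ (r - 1 - c)))"
    by (subst sum_product) (simp only: sum_distrib_left)
  also have "(\<Sum>c<r. \<rho> ^ (r - 1 - c)) = (\<Sum>a<r. \<rho> ^ a)"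
    using sum.nat_diff_reindex[of "\<lambda>i. \<rho> ^ i" r] by simp
  also have "C * ((\<Sum>a<r. \<rho> ^ a) * (\<Sum>a<r. \<rho> ^ a)) \<le> C * (1 / (1 - \<rho>) * (1 / (1 - \<rho>)))"
    using sum_power_le_inverse[OF \<rho>0 \<rho>(2), of r] C0 \<rho>0 \<rho>(2)
    by (intro mult_left_mono mult_mono) (auto intro!: sum_nonneg)
  also have "\<dots> = C / (1 - \<rho>)\<^sup>2" by (simp add: power2_eq_square)
  also have "\<dots> < 1" using \<rho>(2,3) by (simp add: C_def)
  finally show ?thesis
    using ex_proper_coloring[OF H finE n, of r "k * n" n] r k n unfolding M_def by simp
qed

section \<open>Choice of parameters and conclusion\<close>

text \<open>Take \<gamma> = 1 - \<epsilon> and k = \<lceil>(1 - \<epsilon>) * L\<rceil>, so that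
  \<theta> lies between (1 + \<epsilon> / 2) / (L * R) and 1 / ((1 - \<epsilon>) * L * R). Then u
  \<le> n^(1 / R) while exp (- n * \<theta>) \<le> n^(- (1 + \<epsilon> / 2) / R), which leaves n^(-
  \<epsilon> / (2 * R)); for r small against ln n this is at most \<epsilon> / 4, the value used for
  \<rho>.\<close>

lemma coloring_parameters:
  fixes n r :: nat and \<epsilon> :: real
  assumes \<epsilon>: "0 < \<epsilon>" "\<epsilon> < 1" and n: "2 \<le> n" and r: "2 \<le> r"
    and ln1: "1 \<le> ln (real n)"
    and small_r: "real r * (2 / \<epsilon> * ln (4 / \<epsilon>)) \<le> ln (real n)" "real r \<le> ln (real n)"
    and large_n: "4 / \<epsilon> * ln (real n) \<le> real n"
      "exp (2 * (ln (real n))\<^sup>2 / ((1 - \<epsilon>) * real n)) \<le> 1 + \<epsilon> / 2"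
    and H: "uniform_hypergraph n V E" and finE: "finite E"
    and N: "real (card E) \<le> (1 - \<epsilon>) * q' r * (real n / ln (real n)) powr ((real r - 1) / real r) * real r ^ (n - 1)"
  shows "\<exists>f. proper_coloring V E r f"
proof -
  define R where "R = real r"
  define L where "L = real n / ln (real n)"
  define u where "u = (L / R) powr (1 / R)"
  define k where "k = nat \<lceil>(1 - \<epsilon>) * L\<rceil>"
  define \<theta> where "\<theta> = 1 / (R * (real k + 1) - 1)"
  have R: "2 \<le> R" using r by (simp add: R_def)
  have n0: "0 < real n" using n by simp
  have ln0: "0 < ln (real n)" using ln1 by linarith
  have L0: "0 < L" using ln0 n0 unfolding L_def by (intro divide_pos_pos)
  have Ln: "L * ln (real n) = real n" using ln1 by (simp add: L_def)
  \<comment> \<open>This slack absorbs both the rounding in \<open>k\<close> and the summand 1 in k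
    + 1.\<close>
  have L2: "2 \<le> \<epsilon> / 2 * L"
  proof -
    have "4 / \<epsilon> \<le> L" using large_n(1) ln1 by (simp add: L_def le_divide_eq)
    thus ?thesis using \<epsilon> by (simp add: field_simps)
  qed
  have \<gamma>L: "0 < (1 - \<epsilon>) * L" using \<epsilon> L0 by simp
  have k_le: "(1 - \<epsilon>) * L \<le> real k" and k_ge: "real k \<le> (1 - \<epsilon>) * L + 1"
    using \<gamma>L unfolding k_def by linarith+
  have k1: "1 \<le> k" using k_le \<gamma>L by linarith
  have u0: "0 < u" using L0 R by (simp add: u_def)
  have ur: "u ^ r = L / R" using L0 R u0 by (simp add: u_def powr_powr R_def flip: powr_realpow)
  have card: "real (card E) \<le> (1 - \<epsilon>) * (L / u) * R ^ (n - 1)"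
  proof -
    have "q' r * L powr ((R - 1) / R) \<le> R powr (1 / R) * L powr ((R - 1) / R)"
      using q'_le[OF r] by (intro mult_right_mono) (auto simp: R_def)
    also have "\<dots> = L / u"
    proof -
      have "L powr ((R - 1) / R) = L powr (1 - 1 / R)" using R by (simp add: diff_divide_distrib)
      also have "\<dots> = L / L powr (1 / R)" using L0 by (simp add: powr_diff)
      finally show ?thesis using R L0 by (simp add: u_def powr_divide)
    qed
    finally have *: "q' r * L powr ((R - 1) / R) \<le> L / u" .
    have "(1 - \<epsilon>) * (q' r * L powr ((R - 1) / R)) * R ^ (n - 1) \<le> (1 - \<epsilon>) * (L / u) * R ^ (n - 1)"
      using * \<epsilon> R by (intro mult_right_mono mult_left_mono) auto
    thus ?thesis using N by (simp add: L_def R_def mult.assoc)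
  qed
  have den: "(1 - \<epsilon>) * L * R \<le> R * (real k + 1) - 1"
  proof -
    have "(1 - \<epsilon>) * L * R \<le> real k * R" using k_le R by (intro mult_right_mono) auto
    thus ?thesis using R by (simp add: algebra_simps)
  qed
  have den0: "0 < R * (real k + 1) - 1"
    using den \<gamma>L R by (smt (verit) mult_pos_pos)
  have \<theta>: "(1 - \<epsilon>) * L * R * \<theta> \<le> 1" using den den0 by (simp add: \<theta>_def)
  have "u * exp (- real n * \<theta>) \<le> exp (ln (real n) / R) * exp (- (1 + \<epsilon> / 2) * (ln (real n) / R))"
  proof (intro mult_mono)
    have "L / R \<le> real n"
    proof -
      have "L * 1 \<le> L * ln (real n)" using ln1 L0 by (intro mult_left_mono) auto
      moreover have "L / R \<le> L / 1" using R L0 by (intro divide_left_mono) auto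
      ultimately show ?thesis using Ln by simp
    qed
    hence "u \<le> real n powr (1 / R)" unfolding u_def using L0 R by (intro powr_mono2) auto
    thus "u \<le> exp (ln (real n) / R)" using n0 by (simp add: powr_def)
    have "(1 + \<epsilon> / 2) * (R * (real k + 1) - 1) \<le> L * R"
    proof -
      have "R * (real k + 1) - 1 \<le> R * ((1 - \<epsilon>) * L + 2)"
      proof -
        have "R * (real k + 1) \<le> R * ((1 - \<epsilon>) * L + 2)"
          using k_ge R by (intro mult_left_mono) auto
        thus ?thesis by linarith
      qed
      also have "\<dots> \<le> R * ((1 - \<epsilon> / 2) * L)" using L2 R by (intro mult_left_mono) (auto simp: algebra_simps)
      finally have "(1 + \<epsilon> / 2) * (R * (real k + 1) - 1) \<le> (1 + \<epsilon> / 2) * (R * ((1 - \<epsilon> / 2) * L))"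
        using \<epsilon> by (intro mult_left_mono) auto
      also have "\<dots> = (1 - \<epsilon>\<^sup>2 / 4) * (L * R)" by (simp add: power2_eq_square field_simps)
      also have "\<dots> \<le> 1 * (L * R)" using L0 R by (intro mult_right_mono) auto
      finally show ?thesis by simp
    qed
    hence "(1 + \<epsilon> / 2) / (L * R) \<le> \<theta>" using den0 L0 R by (simp add: \<theta>_def field_simps)
    hence "real n * ((1 + \<epsilon> / 2) / (L * R)) \<le> real n * \<theta>" using n0 by (intro mult_left_mono) auto
    moreover have "real n * ((1 + \<epsilon> / 2) / (L * R)) = (1 + \<epsilon> / 2) * (ln (real n) / R)"
    proof -
      have "real n / L = ln (real n)" using Ln L0 by (simp add: field_simps)
      moreover have "real n * ((1 + \<epsilon> / 2) / (L * R)) = (1 + \<epsilon> / 2) * (real n / L / R)" by simp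
      ultimately show ?thesis by (simp only:)
    qed
    ultimately have "- real n * \<theta> \<le> - (1 + \<epsilon> / 2) * (ln (real n) / R)" by linarith
    thus "exp (- real n * \<theta>) \<le> exp (- (1 + \<epsilon> / 2) * (ln (real n) / R))" by (simp only: exp_le_cancel_iff)
  qed auto
  also have "\<dots> = exp (- (\<epsilon> / 2 * ln (real n) / R))"
    by (simp add: algebra_simps flip: exp_add)
  also have "\<dots> \<le> exp (- ln (4 / \<epsilon>))"
  proof -
    have "ln (4 / \<epsilon>) \<le> \<epsilon> / 2 * ln (real n) / R"
      using small_r(1) R \<epsilon> by (simp add: R_def field_simps)
    thus ?thesis by simp
  qed
  also have "\<dots> = \<epsilon> / 4" using \<epsilon> by (simp add: exp_minus)
  finally have \<rho>: "u * exp (- real n * \<theta>) \<le> \<epsilon> / 4" .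
  have "2 * R / ((1 - \<epsilon>) * L) \<le> 2 * (ln (real n))\<^sup>2 / ((1 - \<epsilon>) * real n)"
  proof -
    have "2 * R / ((1 - \<epsilon>) * L) \<le> 2 * ln (real n) / ((1 - \<epsilon>) * L)"
      using small_r(2) \<gamma>L by (intro divide_right_mono) (auto simp: R_def)
    also have "\<dots> = 2 * (ln (real n))\<^sup>2 / ((1 - \<epsilon>) * real n)"
      using ln1 by (simp add: L_def power2_eq_square)
    finally show ?thesis .
  qed
  hence "exp (2 * R / ((1 - \<epsilon>) * L)) \<le> 1 + \<epsilon> / 2" using large_n(2) by (meson exp_le_cancel_iff order.trans)
  hence "(1 - \<epsilon>) * exp (2 * R / ((1 - \<epsilon>) * L)) \<le> (1 - \<epsilon>) * (1 + \<epsilon> / 2)"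
    using \<epsilon> by (intro mult_left_mono) auto
  \<comment> \<open>The left side is 1 - \<epsilon>/2 - \<epsilon>^2/2, the right side 1 -
    \<epsilon>/2 + \<epsilon>^2/16.\<close>
  also have "\<dots> < (1 - \<epsilon> / 4)\<^sup>2" using \<epsilon> by (simp add: power2_eq_square field_simps)
  finally have C: "(1 - \<epsilon>) * exp (2 * R / ((1 - \<epsilon>) * L)) < (1 - \<epsilon> / 4)\<^sup>2" .
  show ?thesis
    by (rule ex_proper_coloring_few_edges[OF H finE n r k1 _ L0 u0, where \<gamma> = "1 - \<epsilon>" and \<rho> = "\<epsilon> / 4"])
       (use \<epsilon> ur card \<theta> \<rho> C in \<open>auto simp: R_def \<theta>_def\<close>)
qed

theorem theorem2:
  fixes r :: "nat \<Rightarrow> nat"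
  assumes "\<forall>n. r n \<ge> 2"
    and "(\<lambda>n. real (r n)) \<in> o[at_top](\<lambda>n. ln (real n) / ln (ln (real n)))"
  shows "\<forall>\<epsilon>::real. 0 < \<epsilon> \<and> \<epsilon> < 1 \<longrightarrow> (\<exists>n0. \<forall>n\<ge>n0.
     real (m_hyp n (r n)) \<ge> (1 - \<epsilon>) * q' (r n)
        * (real n / ln (real n)) powr ((real (r n) - 1) / real (r n)) * real (r n) ^ (n - 1))"
proof (intro allI impI)
  fix \<epsilon> :: real
  assume "0 < \<epsilon> \<and> \<epsilon> < 1"
  hence \<epsilon>: "0 < \<epsilon>" "\<epsilon> < 1" by auto
  \<comment> \<open>With ln (ln n) \<ge> 1, the little-o hypothesis for the constant 1 / K gives r *
    K \<le> ln n; the maximum makes this yield both smallness conditions on r.\<close>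
  define K where "K = max 1 (2 / \<epsilon> * ln (4 / \<epsilon>))"
  have K: "1 \<le> K" "2 / \<epsilon> * ln (4 / \<epsilon>) \<le> K" by (simp_all add: K_def)
  have "eventually (\<lambda>n. norm (real (r n)) \<le> 1 / K * norm (ln (real n) / ln (ln (real n)))) at_top"
    using assms(2) K by (intro landau_o.smallD) auto
  moreover have "eventually (\<lambda>n. 1 \<le> ln (ln (real n))) at_top" by real_asymp
  moreover have "eventually (\<lambda>n. 1 \<le> ln (real n)) at_top" by real_asymp
  moreover have "eventually (\<lambda>n. 4 / \<epsilon> * ln (real n) \<le> real n) at_top" using \<epsilon> by real_asymp
  moreover have "eventually (\<lambda>n. exp (2 * (ln (real n))\<^sup>2 / ((1 - \<epsilon>) * real n)) \<le> 1 + \<epsilon> / 2) at_top"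
  proof -
    have "((\<lambda>n. exp (2 * (ln (real n))\<^sup>2 / ((1 - \<epsilon>) * real n))) \<longlongrightarrow> 1) at_top" using \<epsilon> by real_asymp
    hence "eventually (\<lambda>n. exp (2 * (ln (real n))\<^sup>2 / ((1 - \<epsilon>) * real n)) < 1 + \<epsilon> / 2) at_top"
      using \<epsilon> by (intro order_tendstoD) auto
    thus ?thesis by eventually_elim simp
  qed
  moreover have "eventually (\<lambda>n. 2 \<le> n) (at_top :: nat filter)" by (rule eventually_ge_at_top)
  ultimately have "eventually (\<lambda>n. real (m_hyp n (r n)) \<ge> (1 - \<epsilon>) * q' (r n)
        * (real n / ln (real n)) powr ((real (r n) - 1) / real (r n)) * real (r n) ^ (n - 1)) at_top"
  proof eventually_elim
    case (elim n)
    have "real (r n) \<le> 1 / K * (ln (real n) / ln (ln (real n)))" using elim by simp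
    also have "\<dots> \<le> 1 / K * ln (real n)"
    proof (intro mult_left_mono)
      have "ln (real n) * 1 \<le> ln (real n) * ln (ln (real n))"
        by (rule mult_left_mono) (use elim(2,3) in linarith)+
      moreover have "0 < ln (ln (real n))" using elim(2) by linarith
      ultimately show "ln (real n) / ln (ln (real n)) \<le> ln (real n)"
        by (simp only: pos_divide_le_eq mult_1_right)
    qed (use K in simp)
    finally have rK: "real (r n) * K \<le> ln (real n)" using K by (simp add: field_simps)
    have "real (r n) * c \<le> ln (real n)" if "c \<le> K" for c
      using mult_left_mono[OF that, of "real (r n)"] rK by simp
    from this[OF K(2)] this[OF K(1)]
    have sr: "real (r n) * (2 / \<epsilon> * ln (4 / \<epsilon>)) \<le> ln (real n)" "real (r n) \<le> ln (real n)" by simp_all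
    have r2: "2 \<le> r n" using assms(1) by simp
    obtain V E where VE: "uniform_hypergraph n V E" "finite E" "card E = m_hyp n (r n)"
      "\<And>f. \<not> proper_coloring V E (r n) f"
      using m_hyp_attained[OF elim(6), of "r n"] by blast
    \<comment> \<open>An extremal hypergraph has no proper colouring, so its number of edges must
      exceed the threshold of \<open>coloring_parameters\<close>.\<close>
    have "\<not> real (card E) \<le> (1 - \<epsilon>) * q' (r n)
        * (real n / ln (real n)) powr ((real (r n) - 1) / real (r n)) * real (r n) ^ (n - 1)"
      using coloring_parameters[OF \<epsilon> elim(6) r2 elim(3) sr elim(4,5) VE(1,2)] VE(4) by blast
    thus ?case by (simp add: VE(3))
  qed
  thus "\<exists>n0. \<forall>n\<ge>n0. real (m_hyp n (r n)) \<ge> (1 - \<epsilon>) * q' (r n)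
        * (real n / ln (real n)) powr ((real (r n) - 1) / real (r n)) * real (r n) ^ (n - 1)"
    by (simp add: eventually_at_top_linorder)
qed

end
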